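(* Let $a,b\in\mathbb{R}$, let $f,g$ be smooth real functions of $y$, and consider the Type-III twisted surface in $E_1^3$ $$\Omega(x,y)=\big((a+f\cos(bx)-g\sin(bx))\cosh x,\ f\sin(bx)+g\cos(bx),\ (a+f\cos(bx)-g\sin(bx))\sinh x\big),$$ where $f=f(y)$, $g=g(y)$, $f'=df/dy$, $g'=dg/dy$. Write $$G=-2a^{2}-(1-2b^{2}+\cos(2bx))f^{2}+(2b^{2}-1+\cos(2bx))g^{2}+4ag\sin(bx)+4f\cos(bx)(-a+g\cosh(bx)).$$ Let $p,q,r\in\{1,-1\}$ be the signs of the causal types of the surface, the loxodrome and the meridian respectively ($1$ for spacelike, $-1$ for timelike). Then the differential equations of loxodromes on this surface which cut all meridians at a constant angle $\theta$ are $$\frac{dy}{dx}=\frac{-pqr\,b(fg'-f'g)A^{2}\,G\ \mp\ \frac{B}{2}\,G\,\sqrt{\frac{p\left(2b^{2}(fg'-f'g)^{2}-(f'^{2}+g'^{2})\right)}{2}\,G}}{\Big(2b^{2}(fg'-f'g)^{2}-qr\,(f'^{2}+g'^{2})(-pA^{2}+qr)\Big)\,G},$$ where $$(A,B)=\begin{cases}(\sin\theta,\ \sin(2\theta)) & \text{if } p=1,\\ (\sinh\theta,\ \sinh(2\theta)) & \text{if } p=-1 \text{ and } qr=1,\\ (\cosh\theta,\ \sinh(2\theta)) & \text{if } p=-1\text{ and } qr=-1.\end{cases}$$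
   Context: $E_1^3$ is $\mathbb{R}^3$ with the metric $\langle u,v\rangle=u_1v_1+u_2v_2-u_3v_3$, and $\|u\|=\sqrt{|\langle u,u\rangle|}$. A vector $u$ is spacelike if $\langle u,u\rangle>0$ or $u=0$, and timelike if $\langle u,u\rangle<0$. A curve is spacelike (timelike) if its tangent vectors are everywhere spacelike (timelike). A surface $\Omega(x,y)$ with $g_{11}=\langle\Omega_x,\Omega_x\rangle$, $g_{12}=\langle\Omega_x,\Omega_y\rangle$, $g_{22}=\langle\Omega_y,\Omega_y\rangle$ is spacelike (timelike) if $g_{11}g_{22}-g_{12}^2>0$ (respectively $<0$). Meridians are the curves $y=\text{constant}$, with tangent $\Omega_x$. A loxodrome is a curve on the surface that cuts all meridians at a constant angle $\theta$. With $T=\Omega_x\,dx+\Omega_y\,dy$ denoting the tangent direction of the loxodrome, the Lorentzian angle $\theta$ is understood as follows: - surface, loxodrome and meridian all spacelike: $\theta\in[0,\pi]$ and $\langle\Omega_x,T\rangle=\|\Omega_x\|\|T\|\cos\theta$; - timelike surface, loxodrome and meridian spacelike: $\theta>0$ and $\langle\Omega_x,T\rangle=\varepsilon\|\Omega_x\|\|T\|\cosh\theta$ with $\varepsilon=\pm1$; - timelike surface, one of loxodrome and meridian spacelike and the other timelike: $\theta\ge0$ and $\langle\Omega_x,T\rangle=\varepsilon\|\Omega_x\|\|T\|\sinh\theta$ with $\varepsilon=\pm1$; - timelike surface, loxodrome and meridian timelike: $\theta>0$ and $\langle\Omega_x,T\rangle=-\|\Omega_x\|\|T\|\cosh\thet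a$.
   Formalization: Corrected formula: in G, cosh(bx) becomes sin(bx); in the denominator and under the root G multiplies only the (f'^2+g'^2) term; the radicand's sign is reversed. The denominator and dx are assumed nonzero along the curve, and T is taken up to one global sign. *)

theory Defs
  imports "HOL-Analysis.Analysis"
begin

section \<open>Minkowski 3-space\<close>

definition lip :: "real^3 \<Rightarrow> real^3 \<Rightarrow> real" where
  "lip u v = u$1 * v$1 + u$2 * v$2 - u$3 * v$3"

definition lnorm :: "real^3 \<Rightarrow> real" where
  "lnorm u = sqrt \<bar>lip u u\<bar>"

definition spacelike :: "real^3 \<Rightarrow> bool" where
  "spacelike u \<longleftrightarrow> lip u u > 0 \<or> u = 0"

definition timelike :: "real^3 \<Rightarrow> bool" where
  "timelike u \<longleftrightarrow> lip u u < 0"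

text \<open>The causal sign is \<open>1\<close> for spacelike and \<open>-1\<close> for timelike; no other value is admitted.\<close>

definition vector_sign :: "real \<Rightarrow> real^3 \<Rightarrow> bool" where
  "vector_sign s u \<longleftrightarrow> (s = 1 \<and> spacelike u) \<or> (s = -1 \<and> timelike u)"

section \<open>Surfaces\<close>

definition surf_dx :: "(real \<Rightarrow> real \<Rightarrow> real^3) \<Rightarrow> real \<Rightarrow> real \<Rightarrow> real^3" where
  "surf_dx \<Omega> x y = vector_derivative (\<lambda>s. \<Omega> s y) (at x)"

definition surf_dy :: "(real \<Rightarrow> real \<Rightarrow> real^3) \<Rightarrow> real \<Rightarrow> real \<Rightarrow> real^3" where
  "surf_dy \<Omega> x y = vector_derivative (\<lambda>s. \<Omega> x s) (at y)"

definition first_form_det :: "(real \<Rightarrow> real \<Rightarrow> real^3) \<Rightarrow> real \<Rightarrow> real \<Rightarrow> real" where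
  "first_form_det \<Omega> x y =
     lip (surf_dx \<Omega> x y) (surf_dx \<Omega> x y) * lip (surf_dy \<Omega> x y) (surf_dy \<Omega> x y)
     - (lip (surf_dx \<Omega> x y) (surf_dy \<Omega> x y))\<^sup>2"

definition surface_sign :: "real \<Rightarrow> (real \<Rightarrow> real \<Rightarrow> real^3) \<Rightarrow> (real \<times> real) set \<Rightarrow> bool" where
  "surface_sign s \<Omega> U \<longleftrightarrow>
     (s = 1 \<and> (\<forall>(x, y)\<in>U. first_form_det \<Omega> x y > 0)) \<or>
     (s = -1 \<and> (\<forall>(x, y)\<in>U. first_form_det \<Omega> x y < 0))"

text \<open>Meridians are the parameter curves with constant \<open>y\<close>.\<close>

definition meridian_sign :: "real \<Rightarrow> (real \<Rightarrow> real \<Rightarrow> real^3) \<Rightarrow> (real \<times> real) set \<Rightarrow> bool" where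
  "meridian_sign s \<Omega> U \<longleftrightarrow> (\<forall>(x, y)\<in>U. vector_sign s (surf_dx \<Omega> x y))"

section \<open>Curves on a surface and Lorentzian angles\<close>

text \<open>The tangent \<open>\<Omega>\<^sub>x dx + \<Omega>\<^sub>y dy\<close> of the curve \<open>t \<mapsto> \<Omega> (X t) (Y t)\<close>.\<close>

definition curve_tangent ::
  "(real \<Rightarrow> real \<Rightarrow> real^3) \<Rightarrow> (real \<Rightarrow> real) \<Rightarrow> (real \<Rightarrow> real) \<Rightarrow> real \<Rightarrow> real^3" where
  "curve_tangent \<Omega> X Y t =
     deriv X t *\<^sub>R surf_dx \<Omega> (X t) (Y t) + deriv Y t *\<^sub>R surf_dy \<Omega> (X t) (Y t)"

definition curve_sign ::
  "real \<Rightarrow> (real \<Rightarrow> real \<Rightarrow> real^3) \<Rightarrow> (real \<Rightarrow> real) \<Rightarrow> (real \<Rightarrow> real) \<Rightarrow> real set \<Rightarrow> bool" where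
  "curve_sign s \<Omega> X Y I \<longleftrightarrow> (\<forall>t\<in>I. vector_sign s (curve_tangent \<Omega> X Y t))"

text \<open>In the next two definitions \<open>p\<close>, \<open>q\<close>, \<open>r\<close> are the causal signs of the surface, the
  curve and the meridian. For \<open>p = 1\<close> necessarily \<open>q = r = 1\<close>, since every tangent vector of a
  spacelike surface is spacelike.\<close>

definition angle_range :: "real \<Rightarrow> real \<Rightarrow> real \<Rightarrow> real \<Rightarrow> bool" where
  "angle_range p q r \<theta> \<longleftrightarrow>
     (if p = 1 then 0 \<le> \<theta> \<and> \<theta> \<le> pi
      else if q = r then \<theta> > 0
      else \<theta> \<ge> 0)"

definition lorentz_angle ::
  "real \<Rightarrow> real \<Rightarrow> real \<Rightarrow> real^3 \<Rightarrow> real^3 \<Rightarrow> real \<Rightarrow> bool" where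
  "lorentz_angle p q r u v \<theta> \<longleftrightarrow>
     (if p = 1 then lip u v = lnorm u * lnorm v * cos \<theta>
      else if q = 1 \<and> r = 1 then
        \<exists>\<epsilon>\<in>{1, -1}. lip u v = \<epsilon> * lnorm u * lnorm v * cosh \<theta>
      else if q = -1 \<and> r = -1 then lip u v = - (lnorm u * lnorm v * cosh \<theta>)
      else \<exists>\<epsilon>\<in>{1, -1}. lip u v = \<epsilon> * lnorm u * lnorm v * sinh \<theta>)"

text \<open>A curve on a surface carries no preferred orientation, so its tangent direction is
  determined only up to one global sign \<open>\<sigma>\<close>. Reversing the curve replaces \<open>\<theta>\<close> by \<open>\<pi> - \<theta>\<close> on a
  spacelike surface, and between timelike vectors an angle exists for only one of the two
  orientations.\<close>

definition loxodrome ::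
  "real \<Rightarrow> real \<Rightarrow> real \<Rightarrow> (real \<Rightarrow> real \<Rightarrow> real^3) \<Rightarrow>
   (real \<Rightarrow> real) \<Rightarrow> (real \<Rightarrow> real) \<Rightarrow> real set \<Rightarrow> real \<Rightarrow> bool" where
  "loxodrome p q r \<Omega> X Y I \<theta> \<longleftrightarrow>
     (\<exists>\<sigma>\<in>{1, -1}. \<forall>t\<in>I.
        lorentz_angle p q r (surf_dx \<Omega> (X t) (Y t)) (\<sigma> *\<^sub>R curve_tangent \<Omega> X Y t) \<theta>)"

section \<open>Type-III twisted surfaces\<close>

definition smooth_fun_on :: "real set \<Rightarrow> (real \<Rightarrow> real) \<Rightarrow> bool" where
  "smooth_fun_on J f \<longleftrightarrow> (\<forall>n. \<forall>t\<in>J. (deriv ^^ n) f differentiable (at t))"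

definition twisted3 ::
  "real \<Rightarrow> real \<Rightarrow> (real \<Rightarrow> real) \<Rightarrow> (real \<Rightarrow> real) \<Rightarrow> real \<Rightarrow> real \<Rightarrow> real^3" where
  "twisted3 a b f g x y =
     vector [(a + f y * cos (b * x) - g y * sin (b * x)) * cosh x,
             f y * sin (b * x) + g y * cos (b * x),
             (a + f y * cos (b * x) - g y * sin (b * x)) * sinh x]"

text \<open>\<open>lox_G\<close> is \<open>2 \<langle>\<Omega>\<^sub>x, \<Omega>\<^sub>x\<rangle>\<close>, \<open>b * lox_D\<close> is \<open>\<langle>\<Omega>\<^sub>x, \<Omega>\<^sub>y\<rangle>\<close> and \<open>lox_E\<close> is \<open>\<langle>\<Omega>\<^sub>y, \<Omega>\<^sub>y\<rangle>\<close>. The last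
  factor of \<open>lox_G\<close> contains \<open>sin (b * x)\<close>; the source prints \<open>cosh (b * x)\<close> there, which is a
  misprint.\<close>

definition lox_G :: "real \<Rightarrow> real \<Rightarrow> (real \<Rightarrow> real) \<Rightarrow> (real \<Rightarrow> real) \<Rightarrow> real \<Rightarrow> real \<Rightarrow> real" where
  "lox_G a b f g x y =
     - 2 * a\<^sup>2 - (1 - 2 * b\<^sup>2 + cos (2 * b * x)) * (f y)\<^sup>2
     + (2 * b\<^sup>2 - 1 + cos (2 * b * x)) * (g y)\<^sup>2
     + 4 * a * g y * sin (b * x)
     + 4 * f y * cos (b * x) * (- a + g y * sin (b * x))"

definition lox_D :: "(real \<Rightarrow> real) \<Rightarrow> (real \<Rightarrow> real) \<Rightarrow> real \<Rightarrow> real" where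
  "lox_D f g y = f y * deriv g y - deriv f y * g y"

definition lox_E :: "(real \<Rightarrow> real) \<Rightarrow> (real \<Rightarrow> real) \<Rightarrow> real \<Rightarrow> real" where
  "lox_E f g y = (deriv f y)\<^sup>2 + (deriv g y)\<^sup>2"

definition lox_A :: "real \<Rightarrow> real \<Rightarrow> real \<Rightarrow> real \<Rightarrow> real" where
  "lox_A p q r \<theta> = (if p = 1 then sin \<theta> else if q * r = 1 then sinh \<theta> else cosh \<theta>)"

definition lox_B :: "real \<Rightarrow> real \<Rightarrow> real \<Rightarrow> real \<Rightarrow> real" where
  "lox_B p q r \<theta> = (if p = 1 then sin (2 * \<theta>) else sinh (2 * \<theta>))"

text \<open>In the denominator and under the root the factor \<open>lox_G\<close> belongs to \<open>lox_E\<close> alone, and the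
  radicand is \<open>p\<close> times the determinant of the first fundamental form, hence positive. The source
  prints \<open>lox_G\<close> as a factor of the whole brackets, with the opposite overall sign under the root;
  that version is not homogeneous under scaling of the surface and is false.\<close>

definition lox_den ::
  "real \<Rightarrow> real \<Rightarrow> real \<Rightarrow> real \<Rightarrow> real \<Rightarrow> real \<Rightarrow> (real \<Rightarrow> real) \<Rightarrow> (real \<Rightarrow> real) \<Rightarrow>
   real \<Rightarrow> real \<Rightarrow> real" where
  "lox_den p q r \<theta> a b f g x y =
     2 * b\<^sup>2 * (lox_D f g y)\<^sup>2
     - q * r * lox_E f g y * (- p * (lox_A p q r \<theta>)\<^sup>2 + q * r) * lox_G a b f g x y"

text \<open>The sign \<open>\<mp>\<close> of the formula is the factor \<open>- s\<close>, with \<open>s\<close> ranging over \<open>1\<close> and \<open>-1\<close>.\<close>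

definition lox_num ::
  "real \<Rightarrow> real \<Rightarrow> real \<Rightarrow> real \<Rightarrow> real \<Rightarrow> real \<Rightarrow> real \<Rightarrow> (real \<Rightarrow> real) \<Rightarrow> (real \<Rightarrow> real) \<Rightarrow>
   real \<Rightarrow> real \<Rightarrow> real" where
  "lox_num s p q r \<theta> a b f g x y =
     - p * q * r * b * lox_D f g y * (lox_A p q r \<theta>)\<^sup>2 * lox_G a b f g x y
     - s * (lox_B p q r \<theta> / 2) * lox_G a b f g x y
         * sqrt (- p * (2 * b\<^sup>2 * (lox_D f g y)\<^sup>2 - lox_E f g y * lox_G a b f g x y) / 2)"

end

theory Submission
  imports Defs
begin

text \<open>
  Write \<open>e = \<langle>\<Omega>\<^sub>x, \<Omega>\<^sub>x\<rangle>\<close>, \<open>F = \<langle>\<Omega>\<^sub>x, \<Omega>\<^sub>y\<rangle>\<close>, \<open>E = \<langle>\<Omega>\<^sub>y, \<Omega>\<^sub>y\<rangle>\<close> and \<open>\<lambda> = dy/dx\<close>. Up to the factor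
  \<open>dx\<close> the tangent of the curve is \<open>T = \<Omega>\<^sub>x + \<lambda> \<Omega>\<^sub>y\<close>, so that \<open>\<langle>\<Omega>\<^sub>x, T\<rangle> = e + \<lambda>F\<close> and
  \<open>\<langle>T, T\<rangle> = e + 2\<lambda>F + \<lambda>\<^sup>2E\<close>. Let \<open>C\<close> be \<open>cos \<theta>\<close>, \<open>cosh \<theta>\<close> or \<open>sinh \<theta>\<close>, whichever occurs in the
  definition of the angle. Squaring that definition gives
  \<open>\<langle>\<Omega>\<^sub>x, T\<rangle>\<^sup>2 = C\<^sup>2 qr \<langle>\<Omega>\<^sub>x, \<Omega>\<^sub>x\<rangle>\<langle>T, T\<rangle>\<close>, where \<open>qr\<close> replaces the absolute values because \<open>q\<close> and \<open>r\<close>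
  are the signs of the two norms. The Gram identity
  \<open>\<langle>\<Omega>\<^sub>x, T\<rangle>\<^sup>2 = \<langle>\<Omega>\<^sub>x, \<Omega>\<^sub>x\<rangle>\<langle>T, T\<rangle> - (eE - F\<^sup>2)\<lambda>\<^sup>2\<close> and the relation \<open>1 - qr C\<^sup>2 = pqr A\<^sup>2\<close>, which contains
  the three Pythagorean identities at once, turn this into the quadratic equation
  \<open>pqr A\<^sup>2 e (e + 2\<lambda>F + \<lambda>\<^sup>2E) = (eE - F\<^sup>2) \<lambda>\<^sup>2\<close>. Its discriminant is a multiple of
  \<open>(AC)\<^sup>2 e\<^sup>2 p(eE - F\<^sup>2)\<close>, nonnegative since \<open>p\<close> is the sign of \<open>eE - F\<^sup>2\<close>, and \<open>AC = B/2\<close> by the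
  double angle formulas. Solving it and inserting \<open>e = G/2\<close> and \<open>F = b(fg' - f'g)\<close> from
  \<open>twisted3_metric\<close> gives the asserted formula; \<open>loxodrome_quadratic\<close> is this computation.

  Two sign choices have to be uniform along the curve: the orientation in the definition of a
  loxodrome, and the root of the quadratic equation. Both are recovered from the squared
  equations by connectedness (\<open>constant_sign_of_equal_squares\<close>): two continuous functions on an
  interval with equal squares differ by one global sign if the second has no zero, and trivially
  if it vanishes identically. One of these alternatives always holds, because the functions
  in question are a nowhere vanishing function times a constant, \<open>C\<close> for the orientation and \<open>AC\<close>
  for the root.
\<close>

section \<open>First fundamental form\<close>

lemma has_vector_derivative_vector_3:
  fixes u v w :: "real \<Rightarrow> real"
  assumes "(u has_field_derivative u') (at x)" "(v has_field_derivative v') (at x)"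
    "(w has_field_derivative w') (at x)"
  shows "((\<lambda>s. vector [u s, v s, w s] :: real^3) has_vector_derivative vector [u', v', w']) (at x)"
proof -
  have axes: "(vector [c1, c2, c3] :: real^3) = c1 *\<^sub>R axis 1 1 + c2 *\<^sub>R axis 2 1 + c3 *\<^sub>R axis 3 1"
    for c1 c2 c3 :: real
    by (simp add: vec_eq_iff forall_3 axis_def)
  show ?thesis
    unfolding axes by (auto intro!: derivative_eq_intros assms)
qed

text \<open>
  With \<open>m = f cos (bx) - g sin (bx)\<close>, \<open>k = f sin (bx) + g cos (bx)\<close> and \<open>h = a + m\<close> the surface is
  \<open>(h cosh x, k, h sinh x)\<close>. The pair \<open>(m, k)\<close> is \<open>(f, g)\<close> rotated by \<open>bx\<close>, which gives
  \<open>h\<^sub>x = - bk\<close> and \<open>k\<^sub>x = bm\<close> and makes \<open>m\<^sup>2 + k\<^sup>2\<close>, \<open>mk' - m'k\<close> and \<open>m'\<^sup>2 + k'\<^sup>2\<close> independent of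
  \<open>x\<close>; the hyperbolic rotation by \<open>x\<close> is an isometry and contributes only the term \<open>- h\<^sup>2\<close> to
  \<open>\<langle>\<Omega>\<^sub>x, \<Omega>\<^sub>x\<rangle>\<close>.
\<close>

lemma twisted3_metric:
  assumes "f differentiable (at y)" "g differentiable (at y)"
  shows "lip (surf_dx (twisted3 a b f g) x y) (surf_dx (twisted3 a b f g) x y) = lox_G a b f g x y / 2"
    and "lip (surf_dx (twisted3 a b f g) x y) (surf_dy (twisted3 a b f g) x y) = b * lox_D f g y"
    and "lip (surf_dy (twisted3 a b f g) x y) (surf_dy (twisted3 a b f g) x y) = lox_E f g y"
proof -
  have f': "(f has_field_derivative deriv f y) (at y)" and g': "(g has_field_derivative deriv g y) (at y)"
    using assms by (simp_all add: DERIV_deriv_iff_real_differentiable)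
  define c s where "c = cos (b * x)" and "s = sin (b * x)"
  define h k m where "h = a + f y * c - g y * s" and "k = f y * s + g y * c"
    and "m = f y * c - g y * s"
  have dx: "surf_dx (twisted3 a b f g) x y =
      vector [- b * k * cosh x + h * sinh x, b * m, - b * k * sinh x + h * cosh x]"
    unfolding surf_dx_def twisted3_def h_def k_def m_def c_def s_def
    by (rule vector_derivative_at, rule has_vector_derivative_vector_3)
       (auto intro!: derivative_eq_intros simp: algebra_simps)
  have dy: "surf_dy (twisted3 a b f g) x y =
      vector [(deriv f y * c - deriv g y * s) * cosh x, deriv f y * s + deriv g y * c,
              (deriv f y * c - deriv g y * s) * sinh x]"
    unfolding surf_dy_def twisted3_def c_def s_def
    by (rule vector_derivative_at, rule has_vector_derivative_vector_3)
       (auto intro!: derivative_eq_intros f' g' simp: algebra_simps)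
  have cs: "s\<^sup>2 = 1 - c\<^sup>2" unfolding c_def s_def by (rule sin_squared_eq)
  have ch: "(cosh x)\<^sup>2 = (sinh x)\<^sup>2 + 1" by (rule cosh_square_eq)
  have "cos (2 * (b * x)) = 2 * c\<^sup>2 - 1"
    unfolding c_def by (rule cos_double_cos)
  then have c2: "cos (2 * b * x) = 2 * c\<^sup>2 - 1"
    by (simp add: mult.assoc)
  have "lip (surf_dx (twisted3 a b f g) x y) (surf_dx (twisted3 a b f g) x y)
      = b\<^sup>2 * (k\<^sup>2 + m\<^sup>2) - h\<^sup>2"
    unfolding dx lip_def vector_3 using ch by algebra
  also have "\<dots> = lox_G a b f g x y / 2"
    unfolding lox_G_def c2 c_def[symmetric] s_def[symmetric] h_def k_def m_def
    using cs by (simp add: field_simps) algebra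
  finally show "lip (surf_dx (twisted3 a b f g) x y) (surf_dx (twisted3 a b f g) x y) = lox_G a b f g x y / 2" .
  show "lip (surf_dx (twisted3 a b f g) x y) (surf_dy (twisted3 a b f g) x y) = b * lox_D f g y"
    unfolding dx dy lip_def vector_3 lox_D_def k_def m_def using ch cs by algebra
  show "lip (surf_dy (twisted3 a b f g) x y) (surf_dy (twisted3 a b f g) x y) = lox_E f g y"
    unfolding dy lip_def vector_3 lox_E_def using ch cs by algebra
qed

section \<open>Constant signs along a curve\<close>

text \<open>
  Where \<open>v\<close> has no zero, \<open>u / v\<close> is a continuous function with values in \<open>{1, -1}\<close>, hence constant.
\<close>

lemma constant_sign_of_equal_squares:
  fixes u v :: "real \<Rightarrow> real"
  assumes "connected I" "continuous_on I u" "continuous_on I v"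
    and sq: "\<And>t. t \<in> I \<Longrightarrow> (u t)\<^sup>2 = (v t)\<^sup>2"
    and v: "(\<forall>t\<in>I. v t \<noteq> 0) \<or> (\<forall>t\<in>I. v t = 0)"
  shows "\<exists>\<sigma>\<in>{1, -1}. \<forall>t\<in>I. u t = \<sigma> * v t"
proof (cases "\<forall>t\<in>I. v t \<noteq> 0")
  case True
  have sgn: "u t / v t \<in> {1, -1}" if "t \<in> I" for t
    using sq[OF that] True that by (auto simp: power2_eq_iff)
  have "finite ((\<lambda>t. u t / v t) ` I)"
    by (rule finite_subset[OF image_subsetI[OF sgn]]) simp_all
  then have "(\<lambda>t. u t / v t) constant_on I"
    using assms(1-3) True by (intro continuous_finite_range_constant continuous_on_divide) auto
  then obtain \<sigma> where \<sigma>: "\<And>t. t \<in> I \<Longrightarrow> u t / v t = \<sigma>"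
    unfolding constant_on_def by blast
  show ?thesis
  proof (cases "I = {}")
    case False
    then have "\<sigma> \<in> {1, -1}" using sgn \<sigma> by fastforce
    moreover have "\<forall>t\<in>I. u t = \<sigma> * v t" using \<sigma> True by (auto simp: field_simps)
    ultimately show ?thesis by blast
  qed auto
next
  case False
  then show ?thesis using v sq by auto
qed

lemma smooth_fun_on_imp_deriv:
  assumes "smooth_fun_on J f"
  shows "\<And>y. y \<in> J \<Longrightarrow> f differentiable (at y)" "continuous_on J f" "continuous_on J (deriv f)"
proof -
  have "(deriv ^^ n) f differentiable (at y)" if "y \<in> J" for n y
    using assms that by (simp add: smooth_fun_on_def)
  from this[of _ 0] this[of _ 1] show "\<And>y. y \<in> J \<Longrightarrow> f differentiable (at y)"
    and "continuous_on J f" "continuous_on J (deriv f)"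
    by (auto intro!: continuous_at_imp_continuous_on differentiable_imp_continuous_within)
qed

lemma C1_imp_continuous_deriv:
  fixes X :: "real \<Rightarrow> real"
  assumes "X C1_differentiable_on I"
  shows "continuous_on I X" "continuous_on I (deriv X)"
proof -
  have "X differentiable (at t)" if "t \<in> I" for t
    using assms that by (auto simp: C1_differentiable_on_eq)
  moreover from this have "deriv X t = vector_derivative X (at t)" if "t \<in> I" for t
    using that by (simp add: field_derivative_eq_vector_derivative)
  ultimately show "continuous_on I X" "continuous_on I (deriv X)"
    using assms
    by (auto intro!: continuous_at_imp_continuous_on differentiable_imp_continuous_within
        simp: C1_differentiable_on_eq cong: continuous_on_cong)
qed

section \<open>The angle condition\<close>

text \<open>
  The function of \<open>\<theta>\<close> that replaces the Euclidean cosine in each causal case, without the sign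
  that accompanies it there.
\<close>

definition lorentz_cosine :: "real \<Rightarrow> real \<Rightarrow> real \<Rightarrow> real \<Rightarrow> real" where
  "lorentz_cosine p q r \<theta> = (if p = 1 then cos \<theta> else if q * r = 1 then cosh \<theta> else sinh \<theta>)"

text \<open>
  The Pythagorean identity and the double angle formula, written so that \<open>p\<close>, \<open>q\<close>, \<open>r\<close> absorb the
  difference between the circular case and the two hyperbolic ones.
\<close>

lemma lorentz_cosine_relations:
  assumes "p \<in> {1, -1}" "q \<in> {1, -1}" "r \<in> {1, -1}" "p = 1 \<longrightarrow> q * r = 1"
  shows "1 - q * r * (lorentz_cosine p q r \<theta>)\<^sup>2 = p * q * r * (lox_A p q r \<theta>)\<^sup>2"
    and "lox_A p q r \<theta> * lorentz_cosine p q r \<theta> = lox_B p q r \<theta> / 2"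
  using assms
  by (auto simp: lorentz_cosine_def lox_A_def lox_B_def sin_double sinh_double sin_squared_eq
      cosh_square_eq)

text \<open>
  The zero vector counts as spacelike, so the strict inequality has to exclude it.
\<close>

lemma causal_sign_mult_pos:
  assumes "vector_sign s u" "u \<noteq> 0"
  shows "s \<in> {1, -1}" "s * lip u u > 0"
  using assms by (auto simp: vector_sign_def spacelike_def timelike_def)

lemma lip_scaleR_right: "lip u (c *\<^sub>R v) = c * lip u v"
  by (simp add: lip_def algebra_simps)

lemma lnorm_uminus: "lnorm (- v) = lnorm v"
  by (simp add: lnorm_def lip_def)

text \<open>
  Squaring loses a sign. In the cases with a pointwise \<open>\<epsilon>\<close> that sign is free anyway. In the two
  remaining cases, a spacelike surface or two timelike directions, it has to be the orientation
  \<open>\<sigma>\<close>, the same all along the curve; there the continuity and non-degeneracy hypotheses enter.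
\<close>

lemma loxodrome_iff_squared:
  assumes "connected I" "p \<in> {1, -1}" "q \<in> {1, -1}" "r \<in> {1, -1}"
    and M: "\<And>t. M t = surf_dx \<Omega> (X t) (Y t)" and T: "\<And>t. T t = curve_tangent \<Omega> X Y t"
    and cont: "continuous_on I (\<lambda>t. lip (M t) (T t))" "continuous_on I (\<lambda>t. lip (M t) (M t))"
      "continuous_on I (\<lambda>t. lip (T t) (T t))"
    and nz: "\<And>t. t \<in> I \<Longrightarrow> lip (M t) (M t) \<noteq> 0" "\<And>t. t \<in> I \<Longrightarrow> lip (T t) (T t) \<noteq> 0"
  shows "loxodrome p q r \<Omega> X Y I \<theta> \<longleftrightarrow>
    (\<forall>t\<in>I. (lip (M t) (T t))\<^sup>2 =
       (lorentz_cosine p q r \<theta>)\<^sup>2 * \<bar>lip (M t) (M t) * lip (T t) (T t)\<bar>)"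
    (is "?L \<longleftrightarrow> (\<forall>t\<in>I. ?S t)")
proof -
  define C where "C = lorentz_cosine p q r \<theta>"
  define N where "N t = lnorm (M t) * lnorm (T t)" for t
  have N2: "(N t)\<^sup>2 = \<bar>lip (M t) (M t) * lip (T t) (T t)\<bar>" for t
    by (simp add: N_def lnorm_def power_mult_distrib abs_mult)
  then have S: "?S t \<longleftrightarrow> (lip (M t) (T t))\<^sup>2 = (N t * C)\<^sup>2" for t
    by (simp add: C_def power_mult_distrib mult.commute)
  have Nnz: "N t \<noteq> 0" if "t \<in> I" for t
    using nz[OF that] by (simp add: N_def lnorm_def)
  have Ncont: "continuous_on I N"
    unfolding N_def lnorm_def by (intro continuous_intros cont)
  \<comment> \<open>the constant \<open>C\<close> is either zero or not, so \<open>N t * C\<close> vanishes nowhere or everywhere\<close>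
  have global: "(\<exists>\<sigma>\<in>{1, -1}. \<forall>t\<in>I. lip (M t) (T t) = \<sigma> * (N t * C)) \<longleftrightarrow> (\<forall>t\<in>I. ?S t)"
  proof
    assume "\<exists>\<sigma>\<in>{1, -1}. \<forall>t\<in>I. lip (M t) (T t) = \<sigma> * (N t * C)"
    then show "\<forall>t\<in>I. ?S t" unfolding S by auto
  next
    assume "\<forall>t\<in>I. ?S t"
    then show "\<exists>\<sigma>\<in>{1, -1}. \<forall>t\<in>I. lip (M t) (T t) = \<sigma> * (N t * C)"
      unfolding S using assms(1) cont Ncont Nnz
      by (intro constant_sign_of_equal_squares) (auto intro!: continuous_intros)
  qed
  have L: "?L \<longleftrightarrow> (\<exists>\<sigma>\<in>{1, -1}. \<forall>t\<in>I. lorentz_angle p q r (M t) (\<sigma> *\<^sub>R T t) \<theta>)"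
    by (simp add: loxodrome_def M T)
  consider (oriented) "p = 1 \<or> q = -1 \<and> r = -1" | (pointwise) "p = -1" "q = 1 \<or> r = 1"
    using assms(2-4) by auto
  then show ?thesis
  proof cases
    case oriented
    then consider "p = 1" | "p = -1" "q = -1" "r = -1" using assms(2) by auto
    then have "?L \<longleftrightarrow> (\<exists>\<sigma>\<in>{1, -1}. \<forall>t\<in>I. lip (M t) (T t) = \<sigma> * (N t * C))"
    proof cases
      case 1
      have angle: "lorentz_angle p q r (M t) (\<sigma> *\<^sub>R T t) \<theta> \<longleftrightarrow> lip (M t) (T t) = \<sigma> * (N t * C)"
        if "\<sigma> \<in> {1, -1}" for \<sigma> t
        using that 1 lip_scaleR_right[of "M t" "-1" "T t"] lnorm_uminus[of "T t"]
        by (auto simp: lorentz_angle_def lorentz_cosine_def C_def N_def)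
      show ?thesis unfolding L by (simp add: angle del: scaleR_one scaleR_minus_left)
    next
      case 2
      \<comment> \<open>between timelike directions the product is \<open>- N t * C\<close>, which flips \<open>\<sigma>\<close>\<close>
      have angle: "lorentz_angle p q r (M t) (\<sigma> *\<^sub>R T t) \<theta> \<longleftrightarrow> lip (M t) (T t) = - \<sigma> * (N t * C)"
        if "\<sigma> \<in> {1, -1}" for \<sigma> t
        using that 2 lip_scaleR_right[of "M t" "-1" "T t"] lnorm_uminus[of "T t"]
        by (auto simp: lorentz_angle_def lorentz_cosine_def C_def N_def)
      show ?thesis unfolding L
        by (simp add: angle disj_commute del: scaleR_one scaleR_minus_left)
    qed
    with global show ?thesis by simp
  next
    case pointwise
    have "lorentz_angle p q r (M t) (\<sigma> *\<^sub>R T t) \<theta> \<longleftrightarrow> ?S t" if "\<sigma> \<in> {1, -1}" for \<sigma> t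
      unfolding S power2_eq_iff
      using that pointwise assms(3,4) lip_scaleR_right[of "M t" "-1" "T t"] lnorm_uminus[of "T t"]
      by (auto simp: lorentz_angle_def lorentz_cosine_def C_def N_def)
    then show ?thesis unfolding L by blast
  qed
qed

section \<open>Solving the quadratic equation\<close>

text \<open>
  With \<open>l = \<eta>/\<xi>\<close> the left-hand equation is \<open>P = 0\<close> for a polynomial \<open>P\<close> in \<open>l\<close> of degree two
  with leading coefficient \<open>d/2\<close>. Multiplying \<open>P\<close> by \<open>2d\<close> completes the square: the identity
  \<open>2dP = (dl + 2pk A\<^sup>2 F e)\<^sup>2 - (2ACe)\<^sup>2 p(eE - F\<^sup>2)\<close> is the usual derivation of the formula for the
  roots, in a form that does not divide by the leading coefficient.
\<close>

lemma loxodrome_quadratic: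
  fixes e F E \<xi> \<eta> p k A C :: real
  assumes pk: "p\<^sup>2 = 1" "k\<^sup>2 = 1" and AC: "1 - k * C\<^sup>2 = p * k * A\<^sup>2"
    and W: "p * (e * E - F\<^sup>2) \<ge> 0" and "\<xi> \<noteq> 0"
    and den: "d = 2 * F\<^sup>2 - k * E * (- p * A\<^sup>2 + k) * (2 * e)" "d \<noteq> 0"
  shows "(\<xi> * e + \<eta> * F)\<^sup>2 = C\<^sup>2 * (k * e * (\<xi>\<^sup>2 * e + 2 * \<xi> * \<eta> * F + \<eta>\<^sup>2 * E)) \<longleftrightarrow>
    (d * (\<eta> / \<xi>) + 2 * p * k * A\<^sup>2 * F * e)\<^sup>2 = (A * C * (2 * e) * sqrt (p * (e * E - F\<^sup>2)))\<^sup>2"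
proof -
  define l where "l = \<eta> / \<xi>"
  define P where "P = (e + l * F)\<^sup>2 - C\<^sup>2 * (k * e * (e + 2 * l * F + l\<^sup>2 * E))"
  have \<eta>: "\<eta> = l * \<xi>" using \<open>\<xi> \<noteq> 0\<close> by (simp add: l_def)
  have P: "(\<xi> * e + \<eta> * F)\<^sup>2 - C\<^sup>2 * (k * e * (\<xi>\<^sup>2 * e + 2 * \<xi> * \<eta> * F + \<eta>\<^sup>2 * E)) = \<xi>\<^sup>2 * P"
    unfolding \<eta> P_def by (simp add: algebra_simps power2_eq_square)
  have sq: "(A * C * (2 * e) * sqrt (p * (e * E - F\<^sup>2)))\<^sup>2 = (A * C * (2 * e))\<^sup>2 * (p * (e * E - F\<^sup>2))"
    using W by (simp add: power_mult_distrib)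
  have "(d * l + 2 * p * k * A\<^sup>2 * F * e)\<^sup>2 - (A * C * (2 * e))\<^sup>2 * (p * (e * E - F\<^sup>2)) = 2 * d * P"
    unfolding P_def den(1) using pk AC by algebra
  then have "(d * l + 2 * p * k * A\<^sup>2 * F * e)\<^sup>2 - (A * C * (2 * e) * sqrt (p * (e * E - F\<^sup>2)))\<^sup>2 = 2 * d * P"
    unfolding sq .
  then show ?thesis
    using P \<open>\<xi> \<noteq> 0\<close> den(2) unfolding l_def[symmetric]
    by (metis eq_iff_diff_eq_0 mult_eq_0_iff power_eq_0_iff zero_neq_numeral)
qed

section \<open>Loxodromes on twisted surfaces\<close>

theorem theorem4:
  fixes a b p q r \<theta> :: real
    and f g X Y :: "real \<Rightarrow> real"
    and J I :: "real set"
    and U :: "(real \<times> real) set"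
  assumes "open J" and "smooth_fun_on J f" and "smooth_fun_on J g"
    and "open U" and "U \<subseteq> UNIV \<times> J"
    and "surface_sign p (twisted3 a b f g) U"
    and "meridian_sign r (twisted3 a b f g) U"
    and "open I" and "is_interval I"
    and "X C1_differentiable_on I" and "Y C1_differentiable_on I"
    and "\<And>t. t \<in> I \<Longrightarrow> (X t, Y t) \<in> U"
    and "\<And>t. t \<in> I \<Longrightarrow> deriv X t \<noteq> 0"
    and "curve_sign q (twisted3 a b f g) X Y I"
    and "angle_range p q r \<theta>"
    and "\<And>t. t \<in> I \<Longrightarrow> lox_den p q r \<theta> a b f g (X t) (Y t) \<noteq> 0"
  shows "loxodrome p q r (twisted3 a b f g) X Y I \<theta> \<longleftrightarrow>
    (\<exists>s\<in>{1, -1}. \<forall>t\<in>I.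
       deriv Y t / deriv X t =
         lox_num s p q r \<theta> a b f g (X t) (Y t) / lox_den p q r \<theta> a b f g (X t) (Y t))"
proof (cases "I = {}")
  case True
  then show ?thesis by (simp add: loxodrome_def)
next
  case False
  define \<Omega> where "\<Omega> = twisted3 a b f g"
  define \<xi> \<eta> where "\<xi> = deriv X" and "\<eta> = deriv Y"
  define M N T where "M t = surf_dx \<Omega> (X t) (Y t)" and "N t = surf_dy \<Omega> (X t) (Y t)"
    and "T t = curve_tangent \<Omega> X Y t" for t
  define G D E where "G t = lox_G a b f g (X t) (Y t)" and "D t = lox_D f g (Y t)"
    and "E t = lox_E f g (Y t)" for t
  define e F where "e t = G t / 2" and "F t = b * D t" for t
  define Q where "Q t = (\<xi> t)\<^sup>2 * e t + 2 * \<xi> t * \<eta> t * F t + (\<eta> t)\<^sup>2 * E t" for t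
  define d where "d t = lox_den p q r \<theta> a b f g (X t) (Y t)" for t
  define A C where "A = lox_A p q r \<theta>" and "C = lorentz_cosine p q r \<theta>"
  define R where "R t = A * C * (2 * e t) * sqrt (p * (e t * E t - (F t)\<^sup>2))" for t
  note f = smooth_fun_on_imp_deriv[OF assms(2)] and g = smooth_fun_on_imp_deriv[OF assms(3)]
  note X = C1_imp_continuous_deriv[OF assms(10)] and Y = C1_imp_continuous_deriv[OF assms(11)]
  have YJ: "Y t \<in> J" if "t \<in> I" for t
    using assms(5) assms(12)[OF that] by auto
  have connI: "connected I"
    using assms(9) by (rule is_interval_connected)

  have metric: "lip (M t) (M t) = e t" "lip (M t) (N t) = F t" "lip (N t) (N t) = E t"
    if "t \<in> I" for t
    unfolding M_def N_def \<Omega>_def e_def F_def G_def D_def E_def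
    by (rule twisted3_metric[OF f(1)[OF YJ[OF that]] g(1)[OF YJ[OF that]]])+
  have tangent: "T t = \<xi> t *\<^sub>R M t + \<eta> t *\<^sub>R N t" for t
    by (simp add: T_def M_def N_def \<xi>_def \<eta>_def curve_tangent_def)
  have lip_MT: "lip (M t) (T t) = \<xi> t * e t + \<eta> t * F t"
    and lip_NT: "lip (N t) (T t) = \<xi> t * F t + \<eta> t * E t"
    and lip_TT: "lip (T t) (T t) = Q t" if "t \<in> I" for t
    unfolding Q_def metric[OF that, symmetric] tangent lip_def
    by (simp_all add: algebra_simps power2_eq_square)

  have p: "p \<in> {1, -1}" and W: "\<And>t. t \<in> I \<Longrightarrow> p * (e t * E t - (F t)\<^sup>2) > 0"
  proof -
    show "p \<in> {1, -1}" using assms(6) by (auto simp: surface_sign_def)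
    fix t assume t: "t \<in> I"
    have "first_form_det \<Omega> (X t) (Y t) = e t * E t - (F t)\<^sup>2"
      unfolding first_form_det_def metric[OF t, symmetric] M_def N_def ..
    then show "p * (e t * E t - (F t)\<^sup>2) > 0"
      using assms(6) assms(12)[OF t] by (fastforce simp: surface_sign_def \<Omega>_def)
  qed
  have \<xi>: "\<xi> t \<noteq> 0" if "t \<in> I" for t using assms(13)[OF that] by (simp add: \<xi>_def)
  have lip0: "lip 0 v = 0" "lip v 0 = 0" for v by (simp_all add: lip_def)
  \<comment> \<open>a zero tangent vector would make the first fundamental form degenerate\<close>
  have r: "r \<in> {1, -1}" "r * e t > 0" if t: "t \<in> I" for t
  proof -
    have "M t \<noteq> 0" using metric(1,2)[OF t] W[OF t] by (auto simp: lip0)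
    moreover have "vector_sign r (M t)"
      using assms(7) assms(12)[OF t] by (auto simp: meridian_sign_def M_def \<Omega>_def)
    ultimately show "r \<in> {1, -1}" "r * e t > 0"
      using causal_sign_mult_pos metric(1)[OF t] by metis+
  qed
  have q: "q \<in> {1, -1}" "q * Q t > 0" if t: "t \<in> I" for t
  proof -
    have "T t \<noteq> 0"
    proof
      assume "T t = 0"
      then have "\<xi> t * e t + \<eta> t * F t = 0" "\<xi> t * F t + \<eta> t * E t = 0"
        using lip_MT[OF t] lip_NT[OF t] by (auto simp: lip0)
      then have "\<xi> t * (e t * E t - (F t)\<^sup>2) = 0" by algebra
      then show False using \<xi>[OF t] W[OF t] by simp
    qed
    moreover have "vector_sign q (T t)"
      using assms(14) t by (auto simp: curve_sign_def T_def \<Omega>_def)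
    ultimately show "q \<in> {1, -1}" "q * Q t > 0"
      using causal_sign_mult_pos lip_TT[OF t] by metis+
  qed
  have q1: "q \<in> {1, -1}" and r1: "r \<in> {1, -1}" using q(1) r(1) False by auto
  have qr: "\<bar>e t * Q t\<bar> = q * r * e t * Q t" if "t \<in> I" for t
  proof -
    have "\<bar>e t * Q t\<bar> = \<bar>r * e t\<bar> * \<bar>q * Q t\<bar>" using q1 r1 by (auto simp: abs_mult)
    then show ?thesis using q(2)[OF that] r(2)[OF that] by simp
  qed
  \<comment> \<open>the Gram identity shows that on a spacelike surface both norms have the same sign\<close>
  have spacelike_surface: "p = 1 \<longrightarrow> q * r = 1"
  proof
    assume "p = 1"
    obtain t where t: "t \<in> I" using False by blast
    have "e t * Q t = (\<xi> t * e t + \<eta> t * F t)\<^sup>2 + (e t * E t - (F t)\<^sup>2) * (\<eta> t)\<^sup>2"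
      unfolding Q_def by algebra
    also have "\<dots> \<ge> 0" using W[OF t] \<open>p = 1\<close> by simp
    finally have "e t * Q t \<ge> 0" .
    moreover have "0 < (q * Q t) * (r * e t)" using q(2)[OF t] r(2)[OF t] by simp
    ultimately show "q * r = 1" using q1 r1 by (auto simp: mult.commute)
  qed
  note rel = lorentz_cosine_relations[OF p q1 r1 spacelike_surface, of \<theta>]

  have contGDE: "continuous_on I G" "continuous_on I D" "continuous_on I E"
  proof -
    have fgY: "continuous_on I (\<lambda>t. f (Y t))" "continuous_on I (\<lambda>t. g (Y t))"
      "continuous_on I (\<lambda>t. deriv f (Y t))" "continuous_on I (\<lambda>t. deriv g (Y t))"
      using f(2,3) g(2,3) Y(1) YJ by (auto intro: continuous_on_compose2)
    show "continuous_on I G" "continuous_on I D" "continuous_on I E"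
      unfolding G_def lox_G_def D_def lox_D_def E_def lox_E_def
      by (intro continuous_intros fgY X)+
  qed
  have cont: "continuous_on I \<xi>" "continuous_on I \<eta>" "continuous_on I e" "continuous_on I F"
    unfolding \<xi>_def \<eta>_def e_def F_def by (intro continuous_intros X Y contGDE; simp)+
  have d: "d t = 2 * (F t)\<^sup>2 - q * r * E t * (- p * A\<^sup>2 + q * r) * (2 * e t)" for t
    by (simp add: d_def lox_den_def F_def D_def E_def e_def G_def A_def power_mult_distrib)
  have d0: "d t \<noteq> 0" if "t \<in> I" for t using assms(16)[OF that] by (simp add: d_def)

  have "loxodrome p q r \<Omega> X Y I \<theta> \<longleftrightarrow>
      (\<forall>t\<in>I. (lip (M t) (T t))\<^sup>2 = C\<^sup>2 * \<bar>lip (M t) (M t) * lip (T t) (T t)\<bar>)"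
    unfolding C_def
  proof (rule loxodrome_iff_squared[OF connI p q1 r1 M_def T_def])
    show "continuous_on I (\<lambda>t. lip (M t) (T t))" "continuous_on I (\<lambda>t. lip (M t) (M t))"
      "continuous_on I (\<lambda>t. lip (T t) (T t))"
      by (auto simp: metric lip_MT lip_TT Q_def cong: continuous_on_cong
          intro!: continuous_intros cont contGDE)
    show "lip (M t) (M t) \<noteq> 0" "lip (T t) (T t) \<noteq> 0" if "t \<in> I" for t
      using r(2)[OF that] q(2)[OF that] metric(1)[OF that] lip_TT[OF that] by auto
  qed
  also have "\<dots> \<longleftrightarrow> (\<forall>t\<in>I. (d t * (\<eta> t / \<xi> t) + 2 * p * (q * r) * A\<^sup>2 * F t * e t)\<^sup>2 = (R t)\<^sup>2)"
  proof (rule ball_cong[OF refl])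
    fix t assume t: "t \<in> I"
    have "p\<^sup>2 = 1" "(q * r)\<^sup>2 = 1" using p q1 r1 by auto
    moreover have "1 - (q * r) * C\<^sup>2 = p * (q * r) * A\<^sup>2" using rel(1) by (simp add: A_def C_def)
    ultimately show "(lip (M t) (T t))\<^sup>2 = C\<^sup>2 * \<bar>lip (M t) (M t) * lip (T t) (T t)\<bar> \<longleftrightarrow>
        (d t * (\<eta> t / \<xi> t) + 2 * p * (q * r) * A\<^sup>2 * F t * e t)\<^sup>2 = (R t)\<^sup>2"
      unfolding lip_MT[OF t] lip_TT[OF t] metric[OF t] qr[OF t] unfolding Q_def R_def
      by (rule loxodrome_quadratic[OF _ _ _ less_imp_le[OF W[OF t]] \<xi>[OF t] d d0[OF t]])
  qed
  also have "\<dots> \<longleftrightarrow> (\<exists>s\<in>{1, -1}. \<forall>t\<in>I.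
      d t * (\<eta> t / \<xi> t) + 2 * p * (q * r) * A\<^sup>2 * F t * e t = s * R t)"
  proof
    assume sq: "\<forall>t\<in>I. (d t * (\<eta> t / \<xi> t) + 2 * p * (q * r) * A\<^sup>2 * F t * e t)\<^sup>2 = (R t)\<^sup>2"
    \<comment> \<open>the two roots coincide either at every point of the curve or at none\<close>
    have "R t = 0 \<longleftrightarrow> A * C = 0" if "t \<in> I" for t
      using W[OF that] r(2)[OF that] by (auto simp: R_def)
    then have "(\<forall>t\<in>I. R t \<noteq> 0) \<or> (\<forall>t\<in>I. R t = 0)" by blast
    with sq connI \<xi> show "\<exists>s\<in>{1, -1}. \<forall>t\<in>I.
        d t * (\<eta> t / \<xi> t) + 2 * p * (q * r) * A\<^sup>2 * F t * e t = s * R t"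
      by (intro constant_sign_of_equal_squares)
         (auto simp: d R_def intro!: continuous_intros cont contGDE)
  qed auto
  \<comment> \<open>the formula names its two branches by \<open>- s\<close>\<close>
  also have "\<dots> \<longleftrightarrow> (\<exists>s\<in>{1, -1}. \<forall>t\<in>I.
      d t * (\<eta> t / \<xi> t) + 2 * p * (q * r) * A\<^sup>2 * F t * e t = - s * R t)"
    by (simp add: disj_commute)
  also have "\<dots> \<longleftrightarrow> (\<exists>s\<in>{1, -1}. \<forall>t\<in>I.
      \<eta> t / \<xi> t = lox_num s p q r \<theta> a b f g (X t) (Y t) / d t)"
  proof -
    have num: "lox_num s p q r \<theta> a b f g (X t) (Y t) =
        - s * R t - 2 * p * (q * r) * A\<^sup>2 * F t * e t" for s t
    proof -
      have rad: "- p * (2 * b\<^sup>2 * (D t)\<^sup>2 - E t * G t) / 2 = p * (e t * E t - (F t)\<^sup>2)"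
        by (simp add: e_def F_def field_simps power2_eq_square)
      show ?thesis
        unfolding lox_num_def D_def[symmetric] E_def[symmetric] G_def[symmetric] rad
          R_def A_def[symmetric] rel(2)[symmetric] C_def[symmetric]
        by (simp add: e_def F_def algebra_simps)
    qed
    have "d t * (\<eta> t / \<xi> t) + 2 * p * (q * r) * A\<^sup>2 * F t * e t = - s * R t \<longleftrightarrow>
        \<eta> t / \<xi> t = lox_num s p q r \<theta> a b f g (X t) (Y t) / d t" if "t \<in> I" for s t
      unfolding num using d0[OF that] by (simp only: eq_divide_eq) (auto simp: algebra_simps)
    then show ?thesis by (simp cong: ball_cong)
  qed
  finally show ?thesis
    by (simp only: \<Omega>_def \<xi>_def \<eta>_def d_def)
qed

end
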